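(* Let $X$ be a real Hilbert space, let $T\colon X\to X$ be firmly nonexpansive, let $A\colon X\rightrightarrows X$ be maximally monotone, and suppose that $T=J_A$, or equivalently that $A=T^{-1}-\mathrm{Id}$. Then the following are equivalent: (i) $T$ is sequentially weakly continuous. (ii) $\operatorname{gr}A$ is sequentially weakly closed. (iii) $\mathrm{Id}-T$ is sequentially weakly continuous. (iv) $\operatorname{gr}A^{-1}$ is sequentially weakly closed. Consequently, sequential weak continuity is a self-dual property for firmly nonexpansive mappings; correspondingly, having a sequentially weakly closed graph is a self-dual property for maximally monotone operators.
   Context: $X$ is a real Hilbert space; $\mathrm{Id}$ is the identity on $X$. $T\colon X\to X$ is firmly nonexpansive if $\|Tx-Ty\|^2+\|(\mathrm{Id}-T)x-(\mathrm{Id}-T)y\|^2\leq\|x-y\|^2$ for all $x,y\in X$. For $A\colon X\rightrightarrows X$ (so $Ax\subseteq X$ for each $x$): $\operatorname{gr}A=\{(x,u):u\in Ax\}$ (a subset of $X\times X$, where weak sequential closedness is understood for the weak topology of $X\times X$) and $x\in A^{-1}u\Leftrightarrow u\in Ax$. $A$ is monotone if $\langle x-y,u-v\rangle\geq0$ for all $(x,u),(y,v)\in\operatorname{gr}A$, and maximally monotone if it is monotone with no proper monotone extension. The resolvent of a maximally monotone $A$ is $J_A=(\mathrm{Id}+A)^{-1}\colon X\to X$. A property of firmly nonexpansive mappings on $X$ is self-dual if, for every firmly nonexpansive $T\colon X\to X$, $T$ has it if and only if $\mathrm{Id}-T$ has it; a property of maximally monotone operators on $X$ is self-dual if, for every maximally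 monotone $A$, $A$ has it if and only if $A^{-1}$ has it. *)

theory Defs
  imports "HOL-Analysis.Analysis"
begin

section \<open>Weak topology\<close>

text \<open>The initial topology of the continuous linear functionals. The definition applies to any
  real normed space, in particular to the product of a Hilbert space with itself.\<close>

definition weak_topology :: "'a::real_normed_vector topology" where
  "weak_topology =
     topology_generated_by {f -` U | (f :: 'a \<Rightarrow> real) U. bounded_linear f \<and> open U}"

definition seq_weakly_closed :: "'a::real_normed_vector set \<Rightarrow> bool" where
  "seq_weakly_closed S \<longleftrightarrow>
     (\<forall>\<xi> l. (\<forall>n::nat. \<xi> n \<in> S) \<and> limitin weak_topology \<xi> l sequentially \<longrightarrow> l \<in> S)"

definition seq_weakly_continuous ::
    "('a::real_normed_vector \<Rightarrow> 'b::real_normed_vector) \<Rightarrow> bool" where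
  "seq_weakly_continuous T \<longleftrightarrow>
     (\<forall>\<xi> l. limitin weak_topology \<xi> l sequentially
        \<longrightarrow> limitin weak_topology (\<lambda>n. T (\<xi> n)) (T l) sequentially)"

text \<open>Sanity check: weak convergence is convergence of all continuous linear functionals.\<close>

lemma limitin_weak_topology_iff:
  fixes \<xi> :: "nat \<Rightarrow> 'a::real_normed_vector"
  shows "limitin weak_topology \<xi> l sequentially \<longleftrightarrow>
     (\<forall>f :: 'a \<Rightarrow> real. bounded_linear f \<longrightarrow> (\<lambda>n. f (\<xi> n)) \<longlonglongrightarrow> f l)" (is "?L \<longleftrightarrow> ?R")
proof
  assume L: ?L
  show ?R
  proof (intro allI impI topological_tendstoI)
    fix f :: "'a \<Rightarrow> real" and U assume f: "bounded_linear f" and U: "open U" "f l \<in> U"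
    have "openin weak_topology (f -` U)"
      unfolding weak_topology_def using f U by (intro topology_generated_by_Basis) blast
    then have "\<forall>\<^sub>F n in sequentially. \<xi> n \<in> f -` U"
      using L U unfolding limitin_def by auto
    then show "\<forall>\<^sub>F n in sequentially. f (\<xi> n) \<in> U" by simp
  qed
next
  assume R: ?R
  have "\<forall>\<^sub>F n in sequentially. \<xi> n \<in> V"
    if "generate_topology_on {f -` U | (f :: 'a \<Rightarrow> real) U. bounded_linear f \<and> open U} V" "l \<in> V"
    for V
    using that
  proof (induction rule: generate_topology_on.induct)
    case (Int a b)
    then show ?case by (auto elim: eventually_elim2)
  next
    case (UN K)
    then obtain k where "k \<in> K" "l \<in> k" by blast
    with UN have "\<forall>\<^sub>F n in sequentially. \<xi> n \<in> k" by blast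
    then show ?case by (rule eventually_mono) (use \<open>k \<in> K\<close> in blast)
  next
    case (Basis s)
    then obtain f :: "'a \<Rightarrow> real" and U where fU: "s = f -` U" "bounded_linear f" "open U"
      by blast
    with R Basis topological_tendstoD[of "\<lambda>n. f (\<xi> n)" "f l" sequentially U]
    show ?case by auto
  qed auto
  moreover have "l \<in> topspace weak_topology"
  proof -
    have "UNIV \<in> {f -` U | (f :: 'a \<Rightarrow> real) U. bounded_linear f \<and> open U}"
      using bounded_linear_zero by (intro CollectI exI[of _ "\<lambda>_. 0"] exI[of _ UNIV]) auto
    then show ?thesis unfolding weak_topology_def topology_generated_by_topspace by blast
  qed
  ultimately show ?L
    unfolding limitin_def by (simp add: weak_topology_def openin_topology_generated_by_iff)
qed

section \<open>Set-valued operators\<close>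

definition op_graph :: "('a \<Rightarrow> 'b set) \<Rightarrow> ('a \<times> 'b) set" where
  "op_graph A = {(x, u). u \<in> A x}"

definition op_inverse :: "('a \<Rightarrow> 'b set) \<Rightarrow> 'b \<Rightarrow> 'a set" where
  "op_inverse A u = {x. u \<in> A x}"

text \<open>A single-valued mapping regarded as a set-valued operator.\<close>

definition op_of_fun :: "('a \<Rightarrow> 'b) \<Rightarrow> 'a \<Rightarrow> 'b set" where
  "op_of_fun T x = {T x}"

definition op_add :: "('a \<Rightarrow> 'b::ab_group_add set) \<Rightarrow> ('a \<Rightarrow> 'b set) \<Rightarrow> 'a \<Rightarrow> 'b set" where
  "op_add A B x = {u + v | u v. u \<in> A x \<and> v \<in> B x}"

definition op_diff :: "('a \<Rightarrow> 'b::ab_group_add set) \<Rightarrow> ('a \<Rightarrow> 'b set) \<Rightarrow> 'a \<Rightarrow> 'b set" where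
  "op_diff A B x = {u - v | u v. u \<in> A x \<and> v \<in> B x}"

definition monotone_op :: "('a::real_inner \<Rightarrow> 'a set) \<Rightarrow> bool" where
  "monotone_op A \<longleftrightarrow>
     (\<forall>(x, u) \<in> op_graph A. \<forall>(y, v) \<in> op_graph A. 0 \<le> inner (x - y) (u - v))"

definition maximally_monotone :: "('a::real_inner \<Rightarrow> 'a set) \<Rightarrow> bool" where
  "maximally_monotone A \<longleftrightarrow>
     monotone_op A \<and> \<not> (\<exists>B. monotone_op B \<and> op_graph A \<subset> op_graph B)"

text \<open>The resolvent \<open>(Id + A)\<^sup>-\<^sup>1\<close>, as a set-valued operator. For maximally monotone \<open>A\<close> on a
  Hilbert space it is single-valued with full domain; that it is the mapping \<open>T\<close> is written
  \<open>op_of_fun T = resolvent A\<close>.\<close>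

definition resolvent :: "('a::ab_group_add \<Rightarrow> 'a set) \<Rightarrow> 'a \<Rightarrow> 'a set" where
  "resolvent A = op_inverse (op_add (op_of_fun id) A)"

section \<open>Firmly nonexpansive mappings and self-dual properties\<close>

definition firmly_nonexpansive :: "('a::real_inner \<Rightarrow> 'a) \<Rightarrow> bool" where
  "firmly_nonexpansive T \<longleftrightarrow>
     (\<forall>x y. (norm (T x - T y))\<^sup>2 + (norm ((x - T x) - (y - T y)))\<^sup>2 \<le> (norm (x - y))\<^sup>2)"

definition self_dual_firmly_nonexpansive :: "(('a::real_inner \<Rightarrow> 'a) \<Rightarrow> bool) \<Rightarrow> bool" where
  "self_dual_firmly_nonexpansive P \<longleftrightarrow>
     (\<forall>T. firmly_nonexpansive T \<longrightarrow> (P T \<longleftrightarrow> P (\<lambda>x. x - T x)))"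

definition self_dual_maximally_monotone :: "(('a::real_inner \<Rightarrow> 'a set) \<Rightarrow> bool) \<Rightarrow> bool" where
  "self_dual_maximally_monotone P \<longleftrightarrow>
     (\<forall>A. maximally_monotone A \<longrightarrow> (P A \<longleftrightarrow> P (op_inverse A)))"

end

theory Submission
  imports Defs "HOL-Complex_Analysis.Great_Picard"
begin

text \<open>For \<open>T = J_A\<close> the graph of \<open>A\<close> is \<open>{(T x, x - T x)}\<close>, the image of the graph of \<open>T\<close> under a
  linear change of coordinates. Hence sequential weak continuity of \<open>T\<close> makes the graph of \<open>A\<close>
  sequentially weakly closed. Conversely, if \<open>\<xi> n\<close> converges weakly to \<open>l\<close>, then \<open>\<xi> n\<close> is bounded by
  the uniform boundedness principle, and so is \<open>T (\<xi> n)\<close>; each weak cluster point \<open>y\<close> of \<open>T (\<xi> n)\<close>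
  satisfies \<open>(y, l - y) \<in> gr A\<close>, that is, \<open>y = T l\<close>, and weak sequential compactness of bounded sets
  gives convergence of the whole sequence. The remaining equivalences hold because \<open>Id\<close> and the
  coordinate swap are weakly continuous.\<close>

section \<open>Riesz representation on closed subspaces\<close>

text \<open>The representing vector minimises \<open>\<lambda>z. (norm z)\<^sup>2 - 2 * f z\<close> over \<open>V\<close>.\<close>

lemma riesz_representation_subspace:
  fixes V :: "'a::{real_inner, complete_space} set" and f :: "'a \<Rightarrow> real"
  assumes V: "subspace V" "closed V"
    and add: "\<And>u v. u \<in> V \<Longrightarrow> v \<in> V \<Longrightarrow> f (u + v) = f u + f v"
    and scale: "\<And>c v. v \<in> V \<Longrightarrow> f (c *\<^sub>R v) = c * f v"
    and bound: "\<And>v. v \<in> V \<Longrightarrow> \<bar>f v\<bar> \<le> M * norm v"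
  obtains y where "y \<in> V" "\<And>z. z \<in> V \<Longrightarrow> inner y z = f z"
proof -
  define \<phi> where "\<phi> z = (norm z)\<^sup>2 - 2 * f z" for z
  define I where "I = Inf (\<phi> ` V)"
  \<comment> \<open>Completing the square: \<open>f z \<le> M * norm z\<close> gives
    \<open>\<phi> z \<ge> (norm z - M)^2 - M^2\<close>.\<close>
  have lower: "- M\<^sup>2 \<le> \<phi> z" if "z \<in> V" for z
  proof -
    have "0 \<le> (norm z - M)\<^sup>2" by simp
    then show ?thesis using bound[OF that] unfolding \<phi>_def by (simp add: power2_diff abs_le_iff mult.commute)
  qed
  have bdd: "bdd_below (\<phi> ` V)" using lower by (rule bdd_belowI2)
  have ne: "\<phi> ` V \<noteq> {}" using subspace_0[OF V(1)] by auto
  have I_le: "I \<le> \<phi> z" if "z \<in> V" for z unfolding I_def using bdd that by (simp add: cINF_lower)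
  have "\<exists>z\<in>V. \<phi> z < I + inverse (real (Suc n))" for n
    using cInf_lessD[OF ne, of "I + inverse (real (Suc n))"] unfolding I_def by auto
  then obtain s where sV: "\<And>n. s n \<in> V" and s: "\<And>n. \<phi> (s n) < I + inverse (real (Suc n))"
    by metis
  \<comment> \<open>By the parallelogram law the left side equals
    \<open>2 * \<phi> (s m) + 2 * \<phi> (s n) - 4 * \<phi> ?h\<close> for the midpoint
    \<open>?h\<close>; since \<open>\<phi> ?h \<ge> I\<close>, all multiples of \<open>I\<close>
    cancel.\<close>
  have dist_s: "(norm (s m - s n))\<^sup>2 \<le> 2 * inverse (real (Suc m)) + 2 * inverse (real (Suc n))" for m n
  proof -
    let ?h = "(1/2) *\<^sub>R (s m + s n)"
    have "?h \<in> V" using sV V(1) by (simp add: subspace_add subspace_scale)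
    then have "I \<le> \<phi> ?h" by (rule I_le)
    moreover have "4 * \<phi> ?h = (norm (s m + s n))\<^sup>2 - 4 * (f (s m) + f (s n))"
      unfolding \<phi>_def scale[OF subspace_add[OF V(1) sV sV]] add[OF sV sV]
      by (simp add: power_divide add_divide_distrib)
    moreover have "(norm (s m - s n))\<^sup>2 + (norm (s m + s n))\<^sup>2 = 2 * (norm (s m))\<^sup>2 + 2 * (norm (s n))\<^sup>2"
      by (simp add: power2_norm_eq_inner inner_simps inner_commute)
    moreover have "\<phi> (s k) = (norm (s k))\<^sup>2 - 2 * f (s k)" for k by (simp add: \<phi>_def)
    ultimately show ?thesis using s[of m] s[of n] by (smt (verit))
  qed
  have "Cauchy s"
  proof (rule metric_CauchyI)
    fix e :: real assume e: "0 < e"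
    then obtain N where N: "inverse (real (Suc N)) < e\<^sup>2 / 4"
      using reals_Archimedean[of "e\<^sup>2 / 4"] by auto
    have "dist (s m) (s n) < e" if "m \<ge> N" "n \<ge> N" for m n
    proof -
      have "inverse (real (Suc m)) \<le> inverse (real (Suc N))"
        "inverse (real (Suc n)) \<le> inverse (real (Suc N))"
        using that by (auto intro!: le_imp_inverse_le)
      then have "(norm (s m - s n))\<^sup>2 < e\<^sup>2" using dist_s[of m n] N by linarith
      then show ?thesis using e by (simp add: dist_norm power_less_imp_less_base)
    qed
    then show "\<exists>N. \<forall>m\<ge>N. \<forall>n\<ge>N. dist (s m) (s n) < e" by blast
  qed
  then obtain y where y: "s \<longlonglongrightarrow> y" using Cauchy_convergent convergent_def by blast
  have yV: "y \<in> V" using closed_sequentially[OF V(2)] sV y by blast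
  moreover have "inner y z = f z" if z: "z \<in> V" for z
  proof -
    define d where "d = inner y z - f z"
    \<comment> \<open>First variation in the direction \<open>z\<close>. As \<open>s n\<close> is
      only a near-minimiser, comparing \<open>I\<close> with
      \<open>\<phi> (s n + t *\<^sub>R z)\<close> costs an error
      \<open>inverse (real (Suc n))\<close>, which vanishes in the limit.\<close>
    have var: "0 \<le> 2 * t * d + t\<^sup>2 * (norm z)\<^sup>2" for t
    proof (rule LIMSEQ_le_const)
      have "(\<lambda>n. 2 * t * (inner (s n) z - f z) + t\<^sup>2 * (norm z)\<^sup>2) \<longlonglongrightarrow> 2 * t * d + t\<^sup>2 * (norm z)\<^sup>2"
        unfolding d_def by (intro tendsto_intros y)
      from tendsto_add[OF this LIMSEQ_inverse_real_of_nat]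
      show "(\<lambda>n. 2 * t * (inner (s n) z - f z) + t\<^sup>2 * (norm z)\<^sup>2 + inverse (real (Suc n)))
          \<longlonglongrightarrow> 2 * t * d + t\<^sup>2 * (norm z)\<^sup>2"
        by simp
      have "0 \<le> 2 * t * (inner (s n) z - f z) + t\<^sup>2 * (norm z)\<^sup>2 + inverse (real (Suc n))" for n
      proof -
        have tz: "t *\<^sub>R z \<in> V" using V(1) z by (rule subspace_scale)
        have "I \<le> \<phi> (s n + t *\<^sub>R z)" using subspace_add[OF V(1) sV tz] by (rule I_le)
        also have "\<phi> (s n + t *\<^sub>R z) = \<phi> (s n) + 2 * t * (inner (s n) z - f z) + t\<^sup>2 * (norm z)\<^sup>2"
          unfolding \<phi>_def add[OF sV tz] scale[OF z]
          unfolding power2_norm_eq_inner by (simp add: inner_simps inner_commute algebra_simps power2_eq_square)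
        finally show ?thesis using s[of n] by linarith
      qed
      then show "\<exists>N. \<forall>n\<ge>N. 0 \<le> 2 * t * (inner (s n) z - f z) + t\<^sup>2 * (norm z)\<^sup>2 + inverse (real (Suc n))"
        by blast
    qed
    have "d = 0"
    proof (rule ccontr)
      assume "d \<noteq> 0"
      \<comment> \<open>The summand 1 keeps \<open>N\<close> positive when \<open>z = 0\<close>. At
        \<open>t = - d / N\<close> the quadratic in \<open>var\<close> is negative unless
        \<open>d = 0\<close>.\<close>
      define N where "N = (norm z)\<^sup>2 + 1"
      have N: "N > 0" unfolding N_def by (simp add: add_nonneg_pos)
      have "0 \<le> 2 * (- d / N) * d + (- d / N)\<^sup>2 * (N - 1)" using var[of "- d / N"] by (simp add: N_def)
      also have "\<dots> = - (d\<^sup>2 * (N + 1)) / N\<^sup>2"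
        using N by (simp add: field_simps power2_eq_square)
      also have "\<dots> < 0" using N \<open>d \<noteq> 0\<close> by (simp add: divide_neg_pos)
      finally show False by simp
    qed
    then show ?thesis by (simp add: d_def)
  qed
  ultimately show ?thesis using that by blast
qed

section \<open>Weak convergence and boundedness\<close>

text \<open>Riesz representation on the whole space turns every bounded linear functional into an
  inner product with a fixed vector.\<close>

lemma limitin_weak_topology_iff_inner:
  fixes \<xi> :: "nat \<Rightarrow> 'a::{real_inner, complete_space}"
  shows "limitin weak_topology \<xi> l sequentially \<longleftrightarrow> (\<forall>z. (\<lambda>n. inner (\<xi> n) z) \<longlonglongrightarrow> inner l z)"
proof
  assume "limitin weak_topology \<xi> l sequentially"
  then show "\<forall>z. (\<lambda>n. inner (\<xi> n) z) \<longlonglongrightarrow> inner l z"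
    unfolding limitin_weak_topology_iff using bounded_linear_inner_left by blast
next
  assume R: "\<forall>z. (\<lambda>n. inner (\<xi> n) z) \<longlonglongrightarrow> inner l z"
  show "limitin weak_topology \<xi> l sequentially"
    unfolding limitin_weak_topology_iff
  proof (intro allI impI)
    fix f :: "'a \<Rightarrow> real" assume f: "bounded_linear f"
    then interpret bounded_linear f .
    obtain M where "\<And>x. \<bar>f x\<bar> \<le> M * norm x" using bounded by (auto simp: mult.commute)
    then obtain y where "\<And>z. inner y z = f z"
      using riesz_representation_subspace[of UNIV f M] add scale by (metis UNIV_I closed_UNIV real_scaleR_def subspace_UNIV)
    then show "(\<lambda>n. f (\<xi> n)) \<longlonglongrightarrow> f l" using R by (metis (no_types, lifting) ext inner_commute)
  qed
qed

lemma weak_limit_unique: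
  fixes \<xi> :: "nat \<Rightarrow> 'a::{real_inner, complete_space}"
  assumes "limitin weak_topology \<xi> l sequentially" "limitin weak_topology \<xi> m sequentially"
  shows "l = m"
  using assms unfolding limitin_weak_topology_iff_inner
  by (metis LIMSEQ_unique vector_eq_rdot)

text \<open>Baire category: the closed sets \<open>E k\<close> cover the space, so one of them
  contains a ball, and linearity spreads the bound on that ball to all norms.\<close>

lemma uniform_boundedness_inner:
  fixes \<xi> :: "nat \<Rightarrow> 'a::{real_inner, complete_space}"
  assumes "\<And>z. Bseq (\<lambda>n. inner (\<xi> n) z)"
  shows "Bseq \<xi>"
proof -
  define E where "E k = {z. \<forall>n. \<bar>inner (\<xi> n) z\<bar> \<le> real k}" for k
  have closed_E: "closed (E k)" for k
    unfolding E_def by (intro closed_Collect_all closed_Collect_le continuous_intros)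
  have "\<exists>k. z \<in> E k" for z
  proof -
    obtain K where "\<And>n. \<bar>inner (\<xi> n) z\<bar> \<le> K" using assms[of z] by (auto simp: Bseq_def)
    moreover obtain k where "K \<le> real k" using real_arch_simple by blast
    ultimately show ?thesis unfolding E_def using order_trans by blast
  qed
  then have cover: "\<Union>(range E) = UNIV" by auto
  have "\<exists>k. interior (E k) \<noteq> {}"
  proof (rule ccontr)
    assume "\<nexists>k. interior (E k) \<noteq> {}"
    then have "interior (\<Union>(range E)) = {}"
      using Met_TC.metric_Baire_category_alt[where ?'a='a, of "range E"] closed_E
      by (auto simp: complete_UNIV)
    then show False using cover by simp
  qed
  then obtain k a where "a \<in> interior (E k)" by blast
  then obtain e where e: "e > 0" "cball a e \<subseteq> E k" using mem_interior_cball by blast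
  have "norm (\<xi> n) \<le> 2 * real k / e" for n
  proof -
    \<comment> \<open>Moving from the centre \<open>a\<close> by \<open>e\<close> in the direction
      of \<open>\<xi> n\<close> raises the inner product by \<open>e * norm (\<xi> n)\<close>. Both
      values are at most \<open>k\<close> in modulus, whence the factor 2. If
      \<open>\<xi> n = 0\<close>, then \<open>?z = a\<close>.\<close>
    let ?z = "a + e *\<^sub>R sgn (\<xi> n)"
    have "?z \<in> cball a e" using e(1) by (simp add: dist_norm norm_sgn)
    then have "\<bar>inner (\<xi> n) ?z\<bar> \<le> real k" "\<bar>inner (\<xi> n) a\<bar> \<le> real k"
      using e subsetD[OF e(2), of a] subsetD[OF e(2), of ?z] unfolding E_def by auto
    moreover have "inner (\<xi> n) ?z = inner (\<xi> n) a + e * norm (\<xi> n)"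
      by (cases "\<xi> n = 0")
        (simp_all add: inner_simps sgn_div_norm power2_eq_square flip: power2_norm_eq_inner)
    ultimately have "e * norm (\<xi> n) \<le> 2 * real k" by linarith
    then show ?thesis using e(1) by (simp add: field_simps)
  qed
  then show ?thesis by (rule BseqI')
qed

lemma weakly_convergent_imp_Bseq:
  fixes \<xi> :: "nat \<Rightarrow> 'a::{real_inner, complete_space}"
  assumes "limitin weak_topology \<xi> l sequentially"
  shows "Bseq \<xi>"
proof (rule uniform_boundedness_inner)
  show "Bseq (\<lambda>n. inner (\<xi> n) z)" for z
    using assms convergentI convergent_imp_Bseq unfolding limitin_weak_topology_iff_inner by metis
qed

section \<open>Weak sequential compactness\<close>

text \<open>A diagonal subsequence converges when tested against every \<open>\<xi> m\<close>. The
  vectors with this property form a closed subspace, on which Riesz representation supplies the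
  limit; orthogonal projection extends the convergence to all test vectors.\<close>

lemma weak_sequential_compactness:
  fixes \<xi> :: "nat \<Rightarrow> 'a::{real_inner, complete_space}"
  assumes "Bseq \<xi>"
  obtains r l where "strict_mono r" "limitin weak_topology (\<xi> \<circ> r) l sequentially"
proof -
  obtain M where M: "\<And>n. norm (\<xi> n) \<le> M" using assms by (auto simp: Bseq_def)
  then have M0: "0 \<le> M" using norm_ge_zero order_trans by blast
  have inner_le: "norm (inner (\<xi> n) (\<xi> m)) \<le> M * M" for n m
    using order_trans[OF Cauchy_Schwarz_ineq2 mult_mono[OF M M M0 norm_ge_zero]] by simp
  obtain r :: "nat \<Rightarrow> nat"
    where r: "strict_mono r" and lim_r: "\<And>m. \<exists>l. (\<lambda>n. inner (\<xi> (r n)) (\<xi> m)) \<longlonglongrightarrow> l"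
  \<comment> \<open>The diagonal argument runs over the countable set of indices \<open>m\<close>,
    with the Cauchy-Schwarz bound \<open>M * M\<close> uniform in \<open>n\<close>.\<close>
  proof (rule function_convergent_subsequence[of "UNIV :: nat set" "\<lambda>n m. inner (\<xi> n) (\<xi> m)" "M * M"])
    show "norm (inner (\<xi> n) (\<xi> m)) \<le> M * M" for n m by (rule inner_le)
  qed (use that in simp_all)
  define V where "V = {z. convergent (\<lambda>n. inner (\<xi> (r n)) z)}"
  \<comment> \<open>\<open>lim\<close> is meaningful only where the sequence converges, so
    \<open>f\<close> is treated as a functional on \<open>V\<close> alone.\<close>
  define f where "f z = lim (\<lambda>n. inner (\<xi> (r n)) z)" for z
  have f: "(\<lambda>n. inner (\<xi> (r n)) z) \<longlonglongrightarrow> f z" if "z \<in> V" for z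
    using that by (simp add: V_def f_def convergent_LIMSEQ_iff)
  have f_eq: "f z = a" if "(\<lambda>n. inner (\<xi> (r n)) z) \<longlonglongrightarrow> a" for z a
    using that by (simp add: f_def limI)
  \<comment> \<open>This limit and the next serve twice: for closure of \<open>V\<close> under the
    operations and, through \<open>f_eq\<close>, for linearity of \<open>f\<close> on
    \<open>V\<close>.\<close>
  have addV: "(\<lambda>n. inner (\<xi> (r n)) (u + v)) \<longlonglongrightarrow> f u + f v" if "u \<in> V" "v \<in> V" for u v
    unfolding inner_add_right using that by (intro tendsto_add f)
  have scaleV: "(\<lambda>n. inner (\<xi> (r n)) (c *\<^sub>R v)) \<longlonglongrightarrow> c * f v" if "v \<in> V" for c v
    unfolding inner_scaleR_right using that by (intro tendsto_mult_left f)
  have "subspace V"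
    unfolding subspace_def
  proof (intro conjI allI ballI)
    show "0 \<in> V" by (simp add: V_def convergent_const)
    show "u + v \<in> V" if "u \<in> V" "v \<in> V" for u v
      using addV[OF that] unfolding V_def by (blast intro: convergentI)
    show "c *\<^sub>R v \<in> V" if "v \<in> V" for c v
      using scaleV[OF that] unfolding V_def by (blast intro: convergentI)
  qed
  moreover have "closed V"
    unfolding closed_sequential_limits
  proof (intro allI impI, elim conjE)
    fix v l assume v: "\<forall>n. v n \<in> V" and l: "v \<longlonglongrightarrow> l"
    have "Cauchy (\<lambda>n. inner (\<xi> (r n)) l)"
    proof (rule metric_CauchyI)
      fix e :: real assume e: "0 < e"
      \<comment> \<open>An \<open>e / 3\<close> argument through some \<open>v k\<close> near
        \<open>l\<close>; \<open>M + 1\<close> keeps the denominator positive when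
        \<open>M = 0\<close>.\<close>
      then have "0 < e / (3 * (M + 1))" using M0 by simp
      then obtain k where k: "norm (v k - l) < e / (3 * (M + 1))"
        using LIMSEQ_D[OF l] by blast
      have close: "\<bar>inner (\<xi> (r n)) l - inner (\<xi> (r n)) (v k)\<bar> < e / 3" for n
      proof -
        have "\<bar>inner (\<xi> (r n)) (l - v k)\<bar> \<le> norm (\<xi> (r n)) * norm (l - v k)"
          by (rule Cauchy_Schwarz_ineq2)
        also have "\<dots> \<le> (M + 1) * norm (v k - l)"
          using M[of "r n"] M0 by (intro mult_mono) (auto simp: norm_minus_commute)
        also have "\<dots> < (M + 1) * (e / (3 * (M + 1)))"
          using k M0 by (intro mult_strict_left_mono) auto
        also have "\<dots> = e / 3" using M0 by (simp add: field_simps)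
        finally show ?thesis by (simp add: inner_diff_right)
      qed
      have "Cauchy (\<lambda>n. inner (\<xi> (r n)) (v k))" using v by (simp add: V_def Cauchy_convergent_iff)
      then obtain N where N: "\<And>m n. m \<ge> N \<Longrightarrow> n \<ge> N \<Longrightarrow>
          dist (inner (\<xi> (r m)) (v k)) (inner (\<xi> (r n)) (v k)) < e / 3"
        using e metric_CauchyD[of _ "e / 3"] by (metis divide_pos_pos zero_less_numeral)
      have "dist (inner (\<xi> (r m)) l) (inner (\<xi> (r n)) l) < e" if "m \<ge> N" "n \<ge> N" for m n
        using N[OF that] close[of m] close[of n] unfolding dist_real_def by linarith
      then show "\<exists>N. \<forall>m\<ge>N. \<forall>n\<ge>N. dist (inner (\<xi> (r m)) l) (inner (\<xi> (r n)) l) < e" by blast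
    qed
    then show "l \<in> V" by (simp add: V_def Cauchy_convergent_iff)
  qed
  moreover have fM: "\<bar>f v\<bar> \<le> M * norm v" if "v \<in> V" for v
  proof (rule LIMSEQ_le_const2)
    show "(\<lambda>n. \<bar>inner (\<xi> (r n)) v\<bar>) \<longlonglongrightarrow> \<bar>f v\<bar>" using that by (intro tendsto_rabs f)
    have "\<bar>inner (\<xi> (r n)) v\<bar> \<le> M * norm v" for n
      using Cauchy_Schwarz_ineq2 mult_right_mono[OF M norm_ge_zero] by (rule order_trans)
    then show "\<exists>N. \<forall>n\<ge>N. \<bar>inner (\<xi> (r n)) v\<bar> \<le> M * norm v" by blast
  qed
  ultimately obtain l where l: "l \<in> V" "\<And>z. z \<in> V \<Longrightarrow> inner l z = f z"
    using riesz_representation_subspace[of V f M] addV scaleV f_eq by metis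
  have "(\<lambda>n. inner (\<xi> (r n)) z) \<longlonglongrightarrow> inner l z" for z
  proof -
    \<comment> \<open>Only the orthogonal projection \<open>w\<close> of \<open>z\<close> onto \<open>V\<close> matters, since \<open>l\<close> and all \<open>\<xi> m\<close> lie in \<open>V\<close>.\<close>
    obtain w where w: "w \<in> V" "\<And>v. v \<in> V \<Longrightarrow> inner w v = inner z v"
      using riesz_representation_subspace[OF \<open>subspace V\<close> \<open>closed V\<close>, of "inner z" "norm z"]
      by (auto simp: inner_simps Cauchy_Schwarz_ineq2)
    have "\<xi> m \<in> V" for m using lim_r by (simp add: V_def convergent_def)
    then have "inner (\<xi> m) w = inner (\<xi> m) z" for m using w(2) by (metis inner_commute)
    moreover have "f w = inner l z" using l w by (metis inner_commute)
    ultimately show ?thesis using f[OF w(1)] by simp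
  qed
  then have "limitin weak_topology (\<xi> \<circ> r) l sequentially"
    by (simp add: limitin_weak_topology_iff_inner)
  with r show ?thesis by (rule that)
qed

text \<open>If convergence failed for a test vector, some subsequence would avoid a neighbourhood of
  the limit; by compactness it has a further weakly convergent subsequence, whose limit must be
  \<open>l\<close>, a contradiction.\<close>

lemma weak_limit_if_cluster_points_unique:
  fixes \<xi> :: "nat \<Rightarrow> 'a::{real_inner, complete_space}"
  assumes "Bseq \<xi>"
    and cluster: "\<And>r y. strict_mono r \<Longrightarrow> limitin weak_topology (\<xi> \<circ> r) y sequentially \<Longrightarrow> y = l"
  shows "limitin weak_topology \<xi> l sequentially"
  unfolding limitin_weak_topology_iff_inner
proof (intro allI topological_tendstoI, rule ccontr)
  fix z U assume U: "open U" "inner l z \<in> U"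
    and "\<not> (\<forall>\<^sub>F n in sequentially. inner (\<xi> n) z \<in> U)"
  then obtain r where r: "strict_mono (r :: nat \<Rightarrow> nat)" "\<And>n. inner (\<xi> (r n)) z \<notin> U"
    using not_eventually_sequentiallyD by blast
  have "Bseq (\<xi> \<circ> r)" using Bseq_subseq[OF assms(1)] by (simp add: comp_def)
  then obtain s y where s: "strict_mono s" "limitin weak_topology (\<xi> \<circ> r \<circ> s) y sequentially"
    using weak_sequential_compactness by blast
  with cluster[of "r \<circ> s"] r(1) have "y = l" by (simp add: strict_mono_o comp_assoc)
  with s(2) have "(\<lambda>n. inner (\<xi> (r (s n))) z) \<longlonglongrightarrow> inner l z"
    by (simp add: limitin_weak_topology_iff_inner)
  then have "\<forall>\<^sub>F n in sequentially. inner (\<xi> (r (s n))) z \<in> U" using U by (rule topological_tendstoD)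
  then show False using r(2) by simp
qed

section \<open>Weak limits under linear maps and in products\<close>

lemma limitin_weak_topology_add:
  fixes \<xi> \<eta> :: "nat \<Rightarrow> 'a::real_normed_vector"
  assumes "limitin weak_topology \<xi> l sequentially" "limitin weak_topology \<eta> m sequentially"
  shows "limitin weak_topology (\<lambda>n. \<xi> n + \<eta> n) (l + m) sequentially"
  using assms unfolding limitin_weak_topology_iff
  by (simp add: linear_add bounded_linear.linear tendsto_add)

lemma limitin_weak_topology_diff:
  fixes \<xi> \<eta> :: "nat \<Rightarrow> 'a::real_normed_vector"
  assumes "limitin weak_topology \<xi> l sequentially" "limitin weak_topology \<eta> m sequentially"
  shows "limitin weak_topology (\<lambda>n. \<xi> n - \<eta> n) (l - m) sequentially"
  using assms unfolding limitin_weak_topology_iff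
  by (simp add: linear_diff bounded_linear.linear tendsto_diff)

lemma limitin_weak_topology_bounded_linear:
  fixes \<xi> :: "nat \<Rightarrow> 'a::real_normed_vector"
  assumes g: "bounded_linear g" and "limitin weak_topology \<xi> l sequentially"
  shows "limitin weak_topology (\<lambda>n. g (\<xi> n)) (g l) sequentially"
  using assms(2) bounded_linear_compose[OF _ g] unfolding limitin_weak_topology_iff by blast

text \<open>Projections and the embeddings \<open>(x, 0)\<close> and \<open>(0, y)\<close> are
  bounded linear, and each pair is the sum of its two embedded components.\<close>

lemma limitin_weak_topology_prod_iff:
  fixes \<zeta> :: "nat \<Rightarrow> 'a::real_normed_vector \<times> 'b::real_normed_vector"
  shows "limitin weak_topology \<zeta> p sequentially \<longleftrightarrow>
    limitin weak_topology (\<lambda>n. fst (\<zeta> n)) (fst p) sequentially \<and>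
    limitin weak_topology (\<lambda>n. snd (\<zeta> n)) (snd p) sequentially" (is "?L \<longleftrightarrow> ?R")
proof
  assume ?L
  then show ?R
    using limitin_weak_topology_bounded_linear[OF bounded_linear_fst]
      limitin_weak_topology_bounded_linear[OF bounded_linear_snd] by blast
next
  assume R: ?R
  have "bounded_linear (\<lambda>x::'a. (x, 0::'b))" "bounded_linear (\<lambda>y::'b. (0::'a, y))"
    by (intro bounded_linear_Pair bounded_linear_ident bounded_linear_zero)+
  with R have "limitin weak_topology (\<lambda>n. (fst (\<zeta> n), 0::'b)) (fst p, 0) sequentially"
    "limitin weak_topology (\<lambda>n. (0::'a, snd (\<zeta> n))) (0, snd p) sequentially"
    using limitin_weak_topology_bounded_linear by blast+
  from limitin_weak_topology_add[OF this] show ?L by simp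
qed

section \<open>Resolvents and their graphs\<close>

lemma op_of_fun_eq_resolvent_iff:
  "op_of_fun T = resolvent A \<longleftrightarrow> (\<forall>x y. T x = y \<longleftrightarrow> x - y \<in> A y)"
proof -
  have "resolvent A x = {y. x - y \<in> A y}" for x
    unfolding resolvent_def op_inverse_def op_add_def op_of_fun_def
    by (auto simp: algebra_simps) (metis add_diff_cancel_left' diff_add_cancel add.commute)
  then show ?thesis unfolding fun_eq_iff op_of_fun_def set_eq_iff by auto metis+
qed

lemma eq_op_diff_iff:
  "A = op_diff (op_inverse (op_of_fun T)) (op_of_fun id) \<longleftrightarrow> (\<forall>y u. u \<in> A y \<longleftrightarrow> T (u + y) = y)"
proof -
  have "op_diff (op_inverse (op_of_fun T)) (op_of_fun id) y = {u. T (u + y) = y}" for y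
    unfolding op_diff_def op_inverse_def op_of_fun_def
    by auto (metis add_diff_cancel)
  then show ?thesis by (auto simp: fun_eq_iff set_eq_iff)
qed

text \<open>The substitution \<open>u = x - y\<close> carries one pointwise description into the
  other.\<close>

lemma resolvent_eq_iff:
  "op_of_fun T = resolvent A \<longleftrightarrow> A = op_diff (op_inverse (op_of_fun T)) (op_of_fun id)"
proof -
  have "(\<forall>x y. T x = y \<longleftrightarrow> x - y \<in> A y) \<longleftrightarrow> (\<forall>y u. T (u + y) = y \<longleftrightarrow> u \<in> A y)"
    by (metis add_diff_cancel diff_add_cancel)
  then show ?thesis unfolding op_of_fun_eq_resolvent_iff eq_op_diff_iff by blast
qed

section \<open>Duality of the two properties\<close>

lemma seq_weakly_continuous_Id_minus:
  assumes "seq_weakly_continuous T"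
  shows "seq_weakly_continuous (\<lambda>x. x - T x)"
  using assms unfolding seq_weakly_continuous_def by (simp add: limitin_weak_topology_diff)

text \<open>Passing from \<open>T\<close> to \<open>\<lambda>x. x - T x\<close> is an involution, so
  one implication yields both.\<close>

lemma seq_weakly_continuous_Id_minus_iff:
  "seq_weakly_continuous (\<lambda>x. x - T x) \<longleftrightarrow> seq_weakly_continuous T"
  using seq_weakly_continuous_Id_minus[of T] seq_weakly_continuous_Id_minus[of "\<lambda>x. x - T x"] by auto

lemma seq_weakly_closedD:
  assumes "seq_weakly_closed S" "\<And>n. \<xi> n \<in> S" "limitin weak_topology \<xi> l sequentially"
  shows "l \<in> S"
  using assms by (auto simp: seq_weakly_closed_def)

text \<open>The two graphs are exchanged by the coordinate swap, which preserves weak limits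
  componentwise.\<close>

lemma seq_weakly_closed_op_inverse:
  assumes "seq_weakly_closed (op_graph A)"
  shows "seq_weakly_closed (op_graph (op_inverse A))"
  unfolding seq_weakly_closed_def
proof (intro allI impI, elim conjE)
  fix \<zeta> :: "nat \<Rightarrow> _" and p
  assume "\<forall>n. \<zeta> n \<in> op_graph (op_inverse A)" "limitin weak_topology \<zeta> p sequentially"
  then have "\<forall>n. prod.swap (\<zeta> n) \<in> op_graph A"
    "limitin weak_topology (\<lambda>n. prod.swap (\<zeta> n)) (prod.swap p) sequentially"
    by (auto simp: op_graph_def op_inverse_def limitin_weak_topology_prod_iff case_prod_unfold)
  then have "prod.swap p \<in> op_graph A"
    using seq_weakly_closedD[OF assms, of "\<lambda>n. prod.swap (\<zeta> n)" "prod.swap p"] by simp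
  then show "p \<in> op_graph (op_inverse A)"
    by (auto simp: op_graph_def op_inverse_def case_prod_unfold)
qed

lemma seq_weakly_closed_op_inverse_iff:
  "seq_weakly_closed (op_graph (op_inverse A)) \<longleftrightarrow> seq_weakly_closed (op_graph A)"
proof -
  have "op_inverse (op_inverse A) = A" by (simp add: op_inverse_def fun_eq_iff)
  then show ?thesis
    using seq_weakly_closed_op_inverse[of A] seq_weakly_closed_op_inverse[of "op_inverse A"] by auto
qed

section \<open>Continuity of the resolvent and closedness of the graph\<close>

lemma seq_weakly_closed_graph_if_resolvent_continuous:
  fixes T :: "'a::{real_inner, complete_space} \<Rightarrow> 'a"
  assumes T: "seq_weakly_continuous T" and A: "op_of_fun T = resolvent A"
  shows "seq_weakly_closed (op_graph A)"
  unfolding seq_weakly_closed_def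
proof (intro allI impI, elim conjE)
  fix \<zeta> :: "nat \<Rightarrow> 'a \<times> 'a" and p
  assume mem: "\<forall>n. \<zeta> n \<in> op_graph A" and lim: "limitin weak_topology \<zeta> p sequentially"
  have graph: "q \<in> op_graph A \<longleftrightarrow> T (fst q + snd q) = fst q" for q
    using A unfolding op_of_fun_eq_resolvent_iff op_graph_def by (simp add: case_prod_unfold)
  have fst_lim: "limitin weak_topology (\<lambda>n. fst (\<zeta> n)) (fst p) sequentially"
    and "limitin weak_topology (\<lambda>n. snd (\<zeta> n)) (snd p) sequentially"
    using lim by (simp_all add: limitin_weak_topology_prod_iff)
  then have "limitin weak_topology (\<lambda>n. T (fst (\<zeta> n) + snd (\<zeta> n))) (T (fst p + snd p)) sequentially"
    using T fst_lim unfolding seq_weakly_continuous_def by (simp add: limitin_weak_topology_add)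
  \<comment> \<open>On the graph, \<open>T (fst (\<zeta> n) + snd (\<zeta> n))\<close> is
    \<open>fst (\<zeta> n)\<close>, so both sides are weak limits of one sequence.\<close>
  then have "T (fst p + snd p) = fst p"
    using mem fst_lim weak_limit_unique by (simp add: graph)
  then show "p \<in> op_graph A" by (simp add: graph)
qed

lemma firmly_nonexpansive_imp_nonexpansive:
  assumes "firmly_nonexpansive T"
  shows "norm (T x - T y) \<le> norm (x - y)"
proof (rule power2_le_imp_le)
  show "(norm (T x - T y))\<^sup>2 \<le> (norm (x - y))\<^sup>2"
    using assms unfolding firmly_nonexpansive_def
    by (meson add_increasing2 le_add_same_cancel1 order_trans zero_le_power2)
qed simp

lemma resolvent_continuous_if_seq_weakly_closed_graph:
  fixes T :: "'a::{real_inner, complete_space} \<Rightarrow> 'a"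
  assumes T: "firmly_nonexpansive T" and A: "op_of_fun T = resolvent A"
    and closed: "seq_weakly_closed (op_graph A)"
  shows "seq_weakly_continuous T"
  unfolding seq_weakly_continuous_def
proof (intro allI impI)
  fix \<xi> :: "nat \<Rightarrow> 'a" and l assume lim: "limitin weak_topology \<xi> l sequentially"
  obtain M where M: "\<And>n. norm (\<xi> n) \<le> M"
    using weakly_convergent_imp_Bseq[OF lim] by (auto simp: Bseq_def)
  have "norm (T (\<xi> n)) \<le> norm (T 0) + M" for n
    using firmly_nonexpansive_imp_nonexpansive[OF T, of "\<xi> n" 0] M[of n]
      norm_triangle_ineq2[of "T (\<xi> n)" "T 0"] by simp
  then have "Bseq (\<lambda>n. T (\<xi> n))" by (rule BseqI')
  then show "limitin weak_topology (\<lambda>n. T (\<xi> n)) (T l) sequentially"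
  proof (rule weak_limit_if_cluster_points_unique)
    fix r y assume r: "strict_mono r"
      and "limitin weak_topology ((\<lambda>n. T (\<xi> n)) \<circ> r) y sequentially"
    then have y: "limitin weak_topology (\<lambda>n. T (\<xi> (r n))) y sequentially" by (simp add: comp_def)
    have "limitin weak_topology (\<lambda>n. \<xi> (r n)) l sequentially"
      using limitin_subsequence[OF r lim] by (simp add: comp_def)
    then have "limitin weak_topology (\<lambda>n. \<xi> (r n) - T (\<xi> (r n))) (l - y) sequentially"
      using y by (rule limitin_weak_topology_diff)
    \<comment> \<open>These pairs parametrise points of the graph of \<open>A\<close>, so closedness
      passes to the limit: \<open>(y, l - y)\<close> in the graph means
      \<open>T l = y\<close>.\<close>
    with y have "limitin weak_topology (\<lambda>n. (T (\<xi> (r n)), \<xi> (r n) - T (\<xi> (r n)))) (y, l - y) sequentially"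
      by (simp add: limitin_weak_topology_prod_iff)
    moreover have "(T x, x - T x) \<in> op_graph A" for x
      using A unfolding op_of_fun_eq_resolvent_iff op_graph_def by auto
    ultimately have "(y, l - y) \<in> op_graph A"
      by (rule seq_weakly_closedD[OF closed, rotated])
    then have "T l = y" using A unfolding op_of_fun_eq_resolvent_iff op_graph_def by simp
    then show "y = T l" by simp
  qed
qed

theorem theorem3p18:
  shows
    "(\<forall>(T :: 'a::{real_inner, complete_space} \<Rightarrow> 'a) (A :: 'a \<Rightarrow> 'a set).
        firmly_nonexpansive T \<and> maximally_monotone A \<longrightarrow>
          (op_of_fun T = resolvent A \<longleftrightarrow>
             A = op_diff (op_inverse (op_of_fun T)) (op_of_fun id)) \<and>
          (op_of_fun T = resolvent A \<longrightarrow>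
             (seq_weakly_continuous T \<longleftrightarrow> seq_weakly_closed (op_graph A)) \<and>
             (seq_weakly_closed (op_graph A) \<longleftrightarrow> seq_weakly_continuous (\<lambda>x. x - T x)) \<and>
             (seq_weakly_continuous (\<lambda>x. x - T x) \<longleftrightarrow>
                seq_weakly_closed (op_graph (op_inverse A))))) \<and>
     self_dual_firmly_nonexpansive (seq_weakly_continuous :: ('a \<Rightarrow> 'a) \<Rightarrow> bool) \<and>
     self_dual_maximally_monotone (\<lambda>A :: 'a \<Rightarrow> 'a set. seq_weakly_closed (op_graph A))"
  \<comment> \<open>Rewriting with the two duality equivalences merges (iii) into (i) and (iv) into
    (ii), and makes both self-duality claims instances of reflexivity.\<close>
  unfolding self_dual_firmly_nonexpansive_def self_dual_maximally_monotone_def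
    seq_weakly_continuous_Id_minus_iff seq_weakly_closed_op_inverse_iff
proof (intro conjI allI impI)
  fix T :: "'a \<Rightarrow> 'a" and A :: "'a \<Rightarrow> 'a set"
  assume TA: "firmly_nonexpansive T \<and> maximally_monotone A"
  show "op_of_fun T = resolvent A \<longleftrightarrow> A = op_diff (op_inverse (op_of_fun T)) (op_of_fun id)"
    by (rule resolvent_eq_iff)
  assume "op_of_fun T = resolvent A"
  with TA have "seq_weakly_continuous T \<longleftrightarrow> seq_weakly_closed (op_graph A)"
    using seq_weakly_closed_graph_if_resolvent_continuous[of T A]
      resolvent_continuous_if_seq_weakly_closed_graph[of T A] by auto
  then show "seq_weakly_continuous T \<longleftrightarrow> seq_weakly_closed (op_graph A)"
    "seq_weakly_closed (op_graph A) \<longleftrightarrow> seq_weakly_continuous T"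
    "seq_weakly_continuous T \<longleftrightarrow> seq_weakly_closed (op_graph A)"
    by simp_all
qed (rule refl)+

end
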